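(* Let $\mathcal{D}\subset\mathbb{R}^d$ be the physical domain, let $\Gamma:\mathcal{D}\times\mathcal{D}\to\mathbb{R}$ be the covariance function of a random field $\alpha\in L^2(\mathcal{D}\times\Omega)$, and let $\bar{R}_{\mathbf{i},\mathbf{p}}$, $\mathbf{i}\in\mathcal{I}$, $\mathbf{p}\in\mathbb{N}_0^d$, be the NURBS functions on $\mathcal{D}$ (all as in the context). Choose as finite-dimensional subspace $$\mathcal{S}_h=\mathcal{V}_h=\operatorname{span}\{\bar{R}_{\mathbf{i},\mathbf{p}}\}_{\mathbf{i}\in\mathcal{I}}\subset L^2(\mathcal{D}).$$ Consider the Galerkin variational problem: find $\lambda_h\in\mathbb{R}_0^+$ and $0\neq\phi_h\in\mathcal{V}_h$ such that $$\int_{\mathcal{D}}\left(\int_{\mathcal{D}}\Gamma(\mathbf{x},\mathbf{x}')\phi_h(\mathbf{x}')\,d\mathbf{x}'\right)\psi(\mathbf{x})\,d\mathbf{x}=\lambda_h\int_{\mathcal{D}}\phi_h(\mathbf{x})\psi(\mathbf{x})\,d\mathbf{x}\qquad\text{for all }\psi\in\mathcal{V}_h.$$ Let $n_c=|\mathcal{I}|$ and let $\mathbf{A},\mathbf{B}\in\mathbb{R}^{n_c\times n_c}$ be the matrices, with rows and columns indexed by $\mathcal{I}$, having components $$A_{\mathbf{i}\mathbf{j}}=\int_{\mathcal{D}}\int_{\mathcal{D}}\Gamma(\mathbf{x},\mathbf{x}')\bar{R}_{\mathbf{i},\mathbf{p}}(\mathbf{x})\bar{R}_{\mathbf{j},\mathbf{p}}(\mathbf{x}')\,d\mathbf{x}\,d\mathbf{x}',\qquad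 B_{\mathbf{i}\mathbf{j}}=\int_{\mathcal{D}}\bar{R}_{\mathbf{i},\mathbf{p}}(\mathbf{x})\bar{R}_{\mathbf{j},\mathbf{p}}(\mathbf{x})\,d\mathbf{x},\qquad \mathbf{i},\mathbf{j}\in\mathcal{I}.$$ Then the eigenpairs of the variational problem are obtained by solving the linear matrix eigenvalue problem $\mathbf{A}\mathbf{f}_h=\lambda_h\mathbf{B}\mathbf{f}_h$ for an eigenvalue $\lambda_h\in\mathbb{R}_0^+$ and an eigenvector $\mathbf{f}_h\in\mathbb{R}^{n_c}$. That is, a pair $(\lambda_h,\phi_h)\in\mathbb{R}_0^+\times\mathcal{V}_h$ with $\phi_h\neq 0$ solves the variational problem if and only if $$\phi_h(\mathbf{x})=\sum_{\mathbf{j}\in\mathcal{I}}f_{h,\mathbf{j}}\,\bar{R}_{\mathbf{j},\mathbf{p}}(\mathbf{x})$$ for some nonzero $\mathbf{f}_h=(f_{h,\mathbf{j}})_{\mathbf{j}\in\mathcal{I}}\in\mathbb{R}^{n_c}$ satisfying $\mathbf{A}\mathbf{f}_h=\lambda_h\mathbf{B}\mathbf{f}_h$.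
   Context: Notation: $\mathbb{N}_0=\{0,1,2,\dots\}$, $\mathbb{R}_0^+=[0,\infty)$, $\mathbb{R}^+=(0,\infty)$, $d\in\{1,2,3\}$, $\hat{\mathcal{D}}=[0,1]^d$ (parametric domain). $\mathcal{D}\subset\mathbb{R}^d$ is a bounded domain (physical domain); $L^2(\mathcal{D})$ is the real Hilbert space of square-integrable functions on $\mathcal{D}$ with the usual inner product. Random field: $(\Omega,\mathcal{F},\mathbb{P})$ is a complete probability space with expectation $\mathbb{E}$; $\alpha:\mathcal{D}\times\Omega\to\mathbb{R}$ is a real-valued random field with $\alpha\in L^2(\mathcal{D}\times\Omega)$, $\alpha(\mathbf{x},\cdot)\in L^2(\Omega,\mathcal{F},\mathbb{P})$ for each $\mathbf{x}$, mean $\mu(\mathbf{x})=\mathbb{E}[\alpha(\mathbf{x},\cdot)]$, and covariance function $\Gamma(\mathbf{x},\mathbf{x}')=\mathbb{E}[(\alpha(\mathbf{x},\cdot)-\mu(\mathbf{x}))(\alpha(\mathbf{x}',\cdot)-\mu(\mathbf{x}'))]$. In particular $\Gamma\in L^2(\mathcal{D}\times\mathcal{D})$. B-splines: for each coordinate $k=1,\dots,d$, let $n_k\in\mathbb{N}$, $p_k\in\mathbb{N}_0$ and a knot vector $0=\xi_{k,1}\le\xi_{k,2}\le\dots\le\xi_{k,n_k+p_k+1}=1$ be given, in which each distinct knot value appears at most $p_k+1$ times. Set $N^k_{i,0}(\xi)=1$ if $\xi_{k,i}\le\xi<\xi_{k,i+1}$ and $0$ otherwise, and for degree $q=1,\dots,p_k$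 $$N^k_{i,q}(\xi)=\frac{\xi-\xi_{k,i}}{\xi_{k,i+q}-\xi_{k,i}}N^k_{i,q-1}(\xi)+\frac{\xi_{k,i+q+1}-\xi}{\xi_{k,i+q+1}-\xi_{k,i+1}}N^k_{i+1,q-1}(\xi),$$ with $0/0:=0$. Let $\mathcal{I}=\{\mathbf{i}=(i_1,\dots,i_d):1\le i_k\le n_k\}$, $\mathbf{p}=(p_1,\dots,p_d)$, and $B_{\mathbf{i},\mathbf{p}}(\boldsymbol{\xi})=\prod_{k=1}^dN^k_{i_k,p_k}(\xi_k)$. NURBS: given constant weights $w_{\mathbf{i}}\in\mathbb{R}^+$, $\mathbf{i}\in\mathcal{I}$, set $R_{\mathbf{i},\mathbf{p}}(\boldsymbol{\xi})=w_{\mathbf{i}}B_{\mathbf{i},\mathbf{p}}(\boldsymbol{\xi})/\sum_{\mathbf{j}\in\mathcal{I}}w_{\mathbf{j}}B_{\mathbf{j},\mathbf{p}}(\boldsymbol{\xi})$ on $\hat{\mathcal{D}}$. Given control points $\mathbf{C}_{\mathbf{i}}\in\mathbb{R}^d$, $\mathbf{i}\in\mathcal{I}$, the physical domain $\mathcal{D}$ is the image of $\hat{\mathcal{D}}$ under the geometrical mapping $\mathbf{x}(\boldsymbol{\xi})=\sum_{\mathbf{i}\in\mathcal{I}}R_{\mathbf{i},\mathbf{p}}(\boldsymbol{\xi})\mathbf{C}_{\mathbf{i}}$. The parametric elements $Q$ are the open boxes whose sides are intervals between consecutive distinct knots in each coordinate, and the physical elements are $K=\mathbf{x}(Q)$.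 It is assumed that $\mathbf{x}$ is invertible almost everywhere in $\mathcal{D}$ and has a smooth inverse on each physical element $K$. The NURBS functions on $\mathcal{D}$ are $\bar{R}_{\mathbf{i},\mathbf{p}}=R_{\mathbf{i},\mathbf{p}}\circ\mathbf{x}^{-1}$ (defined almost everywhere); $n_c=|\mathcal{I}|$ is the number of control points. The index $h>0$ denotes the mesh size of the given mesh. *)

theory Defs
  imports "HOL-Probability.Probability" "HOL-Library.Function_Algebras"
begin

section \<open>B-splines\<close>

text \<open>Knots are numbered from 1. The conventions \<open>x / 0 = 0\<close> and \<open>0 * x = 0\<close> implement \<open>0/0 := 0\<close>:
  whenever a denominator vanishes, the B-spline of lower degree next to it is identically zero.\<close>

fun bspline :: "(nat \<Rightarrow> real) \<Rightarrow> nat \<Rightarrow> nat \<Rightarrow> real \<Rightarrow> real" where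
  "bspline t 0 i x = (if t i \<le> x \<and> x < t (i + 1) then 1 else 0)"
| "bspline t (Suc q) i x =
     (x - t i) / (t (i + Suc q) - t i) * bspline t q i x +
     (t (i + Suc q + 1) - x) / (t (i + Suc q + 1) - t (i + 1)) * bspline t q (i + 1) x"

section \<open>NURBS geometry\<close>

record ('d::finite) nurbs =
  num :: "'d \<Rightarrow> nat"
  deg :: "'d \<Rightarrow> nat"
  knot :: "'d \<Rightarrow> nat \<Rightarrow> real"
  weight :: "('d \<Rightarrow> nat) \<Rightarrow> real"
  ctrl :: "('d \<Rightarrow> nat) \<Rightarrow> real ^ 'd"

definition index_set :: "('d::finite) nurbs \<Rightarrow> ('d \<Rightarrow> nat) set" where
  "index_set G = {i. \<forall>k. 1 \<le> i k \<and> i k \<le> num G k}"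

definition knot_vector :: "nat \<Rightarrow> nat \<Rightarrow> (nat \<Rightarrow> real) \<Rightarrow> bool" where
  "knot_vector n p t \<longleftrightarrow>
     t 1 = 0 \<and> t (n + p + 1) = 1 \<and> mono_on {1..n + p + 1} t \<and>
     (\<forall>v. card {j \<in> {1..n + p + 1}. t j = v} \<le> p + 1)"

definition nurbs_data :: "('d::finite) nurbs \<Rightarrow> bool" where
  "nurbs_data G \<longleftrightarrow>
     (\<forall>k. 1 \<le> num G k \<and> knot_vector (num G k) (deg G k) (knot G k)) \<and>
     (\<forall>i\<in>index_set G. 0 < weight G i)"

definition tensor_bspline :: "('d::finite) nurbs \<Rightarrow> ('d \<Rightarrow> nat) \<Rightarrow> real ^ 'd \<Rightarrow> real" where
  "tensor_bspline G i \<xi> = (\<Prod>k\<in>UNIV. bspline (knot G k) (deg G k) (i k) (\<xi> $ k))"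

definition weight_fun :: "('d::finite) nurbs \<Rightarrow> real ^ 'd \<Rightarrow> real" where
  "weight_fun G \<xi> = (\<Sum>j\<in>index_set G. weight G j * tensor_bspline G j \<xi>)"

definition nurbs_param :: "('d::finite) nurbs \<Rightarrow> ('d \<Rightarrow> nat) \<Rightarrow> real ^ 'd \<Rightarrow> real" where
  "nurbs_param G i \<xi> = weight G i * tensor_bspline G i \<xi> / weight_fun G \<xi>"

definition geo_map :: "('d::finite) nurbs \<Rightarrow> real ^ 'd \<Rightarrow> real ^ 'd" where
  "geo_map G \<xi> = (\<Sum>i\<in>index_set G. nurbs_param G i \<xi> *\<^sub>R ctrl G i)"

text \<open>The points of the parametric domain \<open>[0,1]^d\<close> at which the rational functions are defined.
  The weight function is positive in the open cube, except possibly on knot hyperplanes; in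
  particular it vanishes where some \<open>\<xi> $ k = 1\<close>, since the degree-0 B-splines are supported on
  half-open intervals. Without this restriction, \<open>x / 0 = 0\<close> would make \<open>geo_map\<close> send the
  excluded points to the origin.\<close>

definition param_domain :: "('d::finite) nurbs \<Rightarrow> (real ^ 'd) set" where
  "param_domain G = {\<xi> \<in> cbox 0 1. weight_fun G \<xi> \<noteq> 0}"

definition phys_domain :: "('d::finite) nurbs \<Rightarrow> (real ^ 'd) set" where
  "phys_domain G = geo_map G ` param_domain G"

definition knot_values :: "('d::finite) nurbs \<Rightarrow> 'd \<Rightarrow> real set" where
  "knot_values G k = knot G k ` {1..num G k + deg G k + 1}"

definition param_elements :: "('d::finite) nurbs \<Rightarrow> (real ^ 'd) set set" where
  "param_elements G =
     {box a b | a b. \<forall>k. a $ k \<in> knot_values G k \<and> b $ k \<in> knot_values G k \<and> a $ k < b $ k \<and>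
                         {a $ k <..< b $ k} \<inter> knot_values G k = {}}"

text \<open>Continuous differentiability of order \<open>m\<close> through directional derivatives, for functions
  on open sets. The physical elements, where it is used, are open by invariance of domain.\<close>

primrec cont_diff_on ::
  "nat \<Rightarrow> ('a::real_normed_vector \<Rightarrow> 'b::real_normed_vector) \<Rightarrow> 'a set \<Rightarrow> bool" where
  "cont_diff_on 0 f S \<longleftrightarrow> continuous_on S f"
| "cont_diff_on (Suc m) f S \<longleftrightarrow>
     (\<forall>x\<in>S. f differentiable (at x)) \<and>
     (\<forall>v. cont_diff_on m (\<lambda>x. frechet_derivative f (at x) v) S)"

definition smooth_on ::
  "('a::real_normed_vector \<Rightarrow> 'b::real_normed_vector) \<Rightarrow> 'a set \<Rightarrow> bool" where
  "smooth_on f S \<longleftrightarrow> (\<forall>m. cont_diff_on m f S)"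

definition ae_invertible :: "('d::finite) nurbs \<Rightarrow> bool" where
  "ae_invertible G \<longleftrightarrow>
     (AE x in lebesgue_on (phys_domain G). \<exists>!\<xi>. \<xi> \<in> param_domain G \<and> geo_map G \<xi> = x)"

definition elementwise_smooth_inverse :: "('d::finite) nurbs \<Rightarrow> bool" where
  "elementwise_smooth_inverse G \<longleftrightarrow>
     (\<forall>Q\<in>param_elements G.
        inj_on (geo_map G) Q \<and> smooth_on (the_inv_into Q (geo_map G)) (geo_map G ` Q))"

text \<open>The value is unspecified at the points without a unique preimage.\<close>

definition nurbs_phys :: "('d::finite) nurbs \<Rightarrow> ('d \<Rightarrow> nat) \<Rightarrow> real ^ 'd \<Rightarrow> real" where
  "nurbs_phys G i x = nurbs_param G i (the_inv_into (param_domain G) (geo_map G) x)"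

section \<open>Square-integrable functions and random fields\<close>

text \<open>Elements of \<open>L\<^sup>2\<close> are represented by functions; equality in \<open>L\<^sup>2\<close> is equality almost everywhere.\<close>

definition L2 :: "'a measure \<Rightarrow> ('a \<Rightarrow> real) set" where
  "L2 M = {f \<in> borel_measurable M. integrable M (\<lambda>x. (f x)\<^sup>2)}"

definition mean_fun :: "'w measure \<Rightarrow> ('a \<Rightarrow> 'w \<Rightarrow> real) \<Rightarrow> 'a \<Rightarrow> real" where
  "mean_fun P \<alpha> x = (LINT \<omega>|P. \<alpha> x \<omega>)"

definition covariance :: "'w measure \<Rightarrow> ('a \<Rightarrow> 'w \<Rightarrow> real) \<Rightarrow> 'a \<Rightarrow> 'a \<Rightarrow> real" where
  "covariance P \<alpha> x x' = (LINT \<omega>|P. (\<alpha> x \<omega> - mean_fun P \<alpha> x) * (\<alpha> x' \<omega> - mean_fun P \<alpha> x'))"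

definition L2_random_field :: "'a measure \<Rightarrow> 'w measure \<Rightarrow> ('a \<Rightarrow> 'w \<Rightarrow> real) \<Rightarrow> bool" where
  "L2_random_field M P \<alpha> \<longleftrightarrow>
     (\<lambda>(x, \<omega>). \<alpha> x \<omega>) \<in> L2 (M \<Otimes>\<^sub>M P) \<and> (\<forall>x\<in>space M. \<alpha> x \<in> L2 P)"

section \<open>Galerkin discretization\<close>

text \<open>The span is taken in the vector space of real functions with pointwise scaling, and then
  closed under equality almost everywhere.\<close>

definition galerkin_space :: "('d::finite) nurbs \<Rightarrow> (real ^ 'd \<Rightarrow> real) set" where
  "galerkin_space G =
     {\<phi>. \<exists>g \<in> module.span (\<lambda>(c::real) f x. c * f x) (nurbs_phys G ` index_set G).
           AE x in lebesgue_on (phys_domain G). \<phi> x = g x}"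

definition solves_variational ::
  "('a::euclidean_space) set \<Rightarrow> ('a \<Rightarrow> 'a \<Rightarrow> real) \<Rightarrow> ('a \<Rightarrow> real) set \<Rightarrow> real \<Rightarrow> ('a \<Rightarrow> real) \<Rightarrow> bool" where
  "solves_variational D \<Gamma> V l \<phi> \<longleftrightarrow>
     (\<forall>\<psi>\<in>V. (LINT x|lebesgue_on D. (LINT x'|lebesgue_on D. \<Gamma> x x' * \<phi> x') * \<psi> x) =
             l * (LINT x|lebesgue_on D. \<phi> x * \<psi> x))"

definition galerkin_A ::
  "('d::finite) nurbs \<Rightarrow> (real ^ 'd \<Rightarrow> real ^ 'd \<Rightarrow> real) \<Rightarrow> ('d \<Rightarrow> nat) \<Rightarrow> ('d \<Rightarrow> nat) \<Rightarrow> real" where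
  "galerkin_A G \<Gamma> i j =
     (LINT x'|lebesgue_on (phys_domain G). LINT x|lebesgue_on (phys_domain G).
        \<Gamma> x x' * nurbs_phys G i x * nurbs_phys G j x')"

definition galerkin_B :: "('d::finite) nurbs \<Rightarrow> ('d \<Rightarrow> nat) \<Rightarrow> ('d \<Rightarrow> nat) \<Rightarrow> real" where
  "galerkin_B G i j =
     (LINT x|lebesgue_on (phys_domain G). nurbs_phys G i x * nurbs_phys G j x)"

end

theory Submission
  imports Defs
begin

text \<open>
  The algebra is short. Both sides of the weak equation are bilinear in the trial function and the
  test function, and both functions are almost everywhere linear combinations of the finitely many
  NURBS functions. Hence the weak equation for all test functions is equivalent to the
  equation tested with each \<open>nurbs_phys G i\<close>, and this is row \<open>i\<close> of the matrix equation for
  the coefficients of the trial function (\<open>galerkin_iff_matrix_eigenproblem\<close>). The NURBS functions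
  may be linearly dependent, so the coefficients need not be unique; but they cannot all vanish, because
  the function does not.

  The work lies in showing that all integrals converge, on which bilinearity and the exchange of
  integrals in the operator matrix depend.

  First, the NURBS functions must be square integrable on a physical domain of finite measure.
  They are transported by an inverse that is only defined almost everywhere, so measurability is the
  issue. On every half-open knot cell the splines are polynomials; thus the geometry map and the
  parametric NURBS functions are continuous there, and sets cut out by open conditions on the latter
  have \<open>\<sigma>\<close>-compact images (\<open>borel_geo_map_image\<close>). These images are, up to null sets, the preimages of
  open sets under the transported functions (\<open>borel_measurable_nurbs_phys\<close>). Nonnegativity of the splines
  bounds the NURBS functions by 1 and the physical domain by the control points.

  Second, the covariance \<open>\<Gamma> x y\<close> is bounded by \<open>s x * s y\<close> with the standard deviation
  \<open>s\<close> of the field, which is square integrable (\<open>covariance_dominated_kernel\<close>). So the kernel times a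
  product of two square-integrable functions is integrable, and Fubini's theorem applies.
\<close>

section \<open>Half-open knot intervals and B-splines\<close>

lemma bspline_nonzero_obtains:
  assumes "bspline t q i x \<noteq> 0"
  obtains m where "i \<le> m" "m \<le> i + q" "t m \<le> x" "x < t (m + 1)"
proof -
  have "\<exists>m\<ge>i. m \<le> i + q \<and> t m \<le> x \<and> x < t (m + 1)"
    using assms
  proof (induction q arbitrary: i)
    case 0
    then show ?case by (auto split: if_splits)
  next
    case (Suc q)
    then consider "bspline t q i x \<noteq> 0" | "bspline t q (i + 1) x \<noteq> 0" by fastforce
    then show ?case
      by cases (use Suc.IH[of i] Suc.IH[of "i + 1"] in force)+
  qed
  then show thesis using that by blast
qed

text \<open>On the support of each lower-degree spline in the recursion, the affine factor in front of it is
  nonnegative: the support lies to the right of \<open>t i\<close> for the left summand and to the left of the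
  last knot for the right summand.\<close>

lemma bspline_nonneg:
  assumes t: "mono_on {1..N} t" and "1 \<le> i" "i + q + 1 \<le> N"
  shows "0 \<le> bspline t q i x"
  using assms(2,3)
proof (induction q arbitrary: i)
  case 0
  then show ?case by simp
next
  case (Suc q)
  have mono: "t a \<le> t b" if "1 \<le> a" "a \<le> b" "b \<le> N" for a b
    using mono_onD[OF t, of a b] that by simp
  have "0 \<le> (x - t i) / (t (i + Suc q) - t i) * bspline t q i x"
  proof (cases "bspline t q i x = 0")
    case False
    then obtain m where "i \<le> m" "m \<le> i + q" "t m \<le> x" by (rule bspline_nonzero_obtains)
    then have "t i \<le> x" using mono[of i m] Suc.prems by linarith
    then show ?thesis using mono[of i "i + Suc q"] Suc by simp
  qed simp
  moreover have "0 \<le> (t (i + Suc q + 1) - x) / (t (i + Suc q + 1) - t (i + 1)) * bspline t q (i + 1) x"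
  proof (cases "bspline t q (i + 1) x = 0")
    case False
    then obtain m where "i + 1 \<le> m" "m \<le> i + 1 + q" "x < t (m + 1)" by (rule bspline_nonzero_obtains)
    then have "x \<le> t (i + Suc q + 1)" using mono[of "m + 1" "i + Suc q + 1"] Suc.prems by linarith
    then show ?thesis using mono[of "i + 1" "i + Suc q + 1"] Suc by simp
  qed simp
  ultimately show ?case by simp
qed

text \<open>A B-spline may jump at a knot, but it is right-continuous there: degree-0 splines are constant on a
  knot interval that is closed on the left, so the recursion yields a polynomial there. This
  is why the intervals below are half-open rather than open; they cover all points at which some
  spline is nonzero, including the knots.\<close>

lemma continuous_on_bspline:
  assumes t: "mono_on {1..N} t" and m: "1 \<le> m" "m < N" and "1 \<le> i" "i + q + 1 \<le> N"
  shows "continuous_on {t m..<t (m + 1)} (bspline t q i)"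
  using assms(4,5)
proof (induction q arbitrary: i)
  case 0
  have mono: "t a \<le> t b" if "1 \<le> a" "a \<le> b" "b \<le> N" for a b
    using mono_onD[OF t, of a b] that by simp
  have "bspline t 0 i x = (if i = m then 1 else 0)" if "x \<in> {t m..<t (m + 1)}" for x
    using that mono[of "i + 1" m] mono[of "m + 1" i] 0 m by (cases i m rule: linorder_cases) auto
  then show ?case by (simp cong: continuous_on_cong_simp)
next
  case (Suc q)
  have "continuous_on {t m..<t (m + 1)} (\<lambda>x. (x - t i) / (t (i + Suc q) - t i) * bspline t q i x +
     (t (i + Suc q + 1) - x) / (t (i + Suc q + 1) - t (i + 1)) * bspline t q (i + 1) x)"
    unfolding divide_inverse
    by (intro continuous_intros Suc.IH) (use Suc.prems in auto)
  then show ?case by (simp cong: continuous_on_cong_simp)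
qed

section \<open>NURBS on the parametric domain\<close>

lemma finite_multi_indices: "finite {i :: 'd::finite \<Rightarrow> nat. \<forall>k. 1 \<le> i k \<and> i k \<le> n k}"
proof -
  have "{i. \<forall>k. 1 \<le> i k \<and> i k \<le> n k} = (\<Pi>\<^sub>E k\<in>UNIV. {1..n k})"
    by (auto simp: PiE_def Pi_def)
  then show ?thesis by (simp add: finite_PiE)
qed

lemma finite_index_set [simp]: "finite (index_set G)"
  unfolding index_set_def by (rule finite_multi_indices)

lemma nurbs_data_knot_mono:
  assumes "nurbs_data G"
  shows "mono_on {1..num G k + deg G k + 1} (knot G k)"
  using assms by (simp add: nurbs_data_def knot_vector_def)

definition knot_cell :: "('d::finite) nurbs \<Rightarrow> ('d \<Rightarrow> nat) \<Rightarrow> (real ^ 'd) set" where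
  "knot_cell G m = {\<xi>. \<forall>k. \<xi> $ k \<in> {knot G k (m k)..<knot G k (m k + 1)}}"

definition cell_indices :: "('d::finite) nurbs \<Rightarrow> ('d \<Rightarrow> nat) set" where
  "cell_indices G = {m. \<forall>k. 1 \<le> m k \<and> m k \<le> num G k + deg G k}"

lemma finite_cell_indices: "finite (cell_indices G)"
  unfolding cell_indices_def by (rule finite_multi_indices)

lemma tensor_bspline_nonneg:
  assumes "nurbs_data G" "i \<in> index_set G"
  shows "0 \<le> tensor_bspline G i \<xi>"
  unfolding tensor_bspline_def
  by (intro prod_nonneg ballI bspline_nonneg[OF nurbs_data_knot_mono[OF assms(1)]])
     (use assms(2) in \<open>auto simp: index_set_def\<close>)

lemma continuous_on_tensor_bspline:
  assumes "nurbs_data G" "i \<in> index_set G" "m \<in> cell_indices G"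
  shows "continuous_on (knot_cell G m) (tensor_bspline G i)"
proof -
  have "continuous_on (knot_cell G m) (\<lambda>\<xi>. bspline (knot G k) (deg G k) (i k) (\<xi> $ k))" for k
  proof (rule continuous_on_compose2[where f = "\<lambda>\<xi>. \<xi> $ k"])
    show "continuous_on {knot G k (m k)..<knot G k (m k + 1)} (bspline (knot G k) (deg G k) (i k))"
      by (rule continuous_on_bspline[OF nurbs_data_knot_mono[OF assms(1)]])
         (use assms(2,3) in \<open>auto simp: index_set_def cell_indices_def less_Suc_eq_le\<close>)
    show "continuous_on (knot_cell G m) (\<lambda>\<xi>. \<xi> $ k)"
      by (intro continuous_intros)
  qed (auto simp: knot_cell_def)
  then show ?thesis
    unfolding tensor_bspline_def by (intro continuous_on_prod) auto
qed

lemma continuous_on_weight_fun: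
  assumes "nurbs_data G" "m \<in> cell_indices G"
  shows "continuous_on (knot_cell G m) (weight_fun G)"
  unfolding weight_fun_def
  by (intro continuous_intros continuous_on_tensor_bspline assms) auto

lemma continuous_on_nurbs_param:
  assumes "nurbs_data G" "i \<in> index_set G" "m \<in> cell_indices G"
  shows "continuous_on (param_domain G \<inter> knot_cell G m) (nurbs_param G i)"
  unfolding nurbs_param_def
  by (intro continuous_intros continuous_on_subset[OF continuous_on_weight_fun[OF assms(1,3)]]
        continuous_on_subset[OF continuous_on_tensor_bspline[OF assms]])
     (auto simp: param_domain_def)

lemma continuous_on_geo_map:
  assumes "nurbs_data G" "m \<in> cell_indices G"
  shows "continuous_on (param_domain G \<inter> knot_cell G m) (geo_map G)"
  unfolding geo_map_def
  by (intro continuous_intros continuous_on_nurbs_param assms) auto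

text \<open>Where the weight function does not vanish, some tensor-product spline is nonzero; in each coordinate
  this puts the point into one of the knot intervals of that spline's support.\<close>

lemma param_domain_eq_Union_cells:
  "param_domain G = (\<Union>m\<in>cell_indices G. param_domain G \<inter> knot_cell G m)"
proof -
  have "\<exists>m\<in>cell_indices G. \<xi> \<in> knot_cell G m" if \<xi>: "\<xi> \<in> param_domain G" for \<xi>
  proof -
    have "(\<Sum>j\<in>index_set G. weight G j * tensor_bspline G j \<xi>) \<noteq> 0"
      using \<xi> by (simp add: param_domain_def weight_fun_def)
    then obtain j where j: "j \<in> index_set G" "tensor_bspline G j \<xi> \<noteq> 0"
      using sum.not_neutral_contains_not_neutral by force
    have "\<exists>l. 1 \<le> l \<and> l \<le> num G k + deg G k \<and> \<xi> $ k \<in> {knot G k l..<knot G k (l + 1)}" for k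
    proof -
      have "bspline (knot G k) (deg G k) (j k) (\<xi> $ k) \<noteq> 0"
        using j(2) by (simp add: tensor_bspline_def)
      then obtain l where "j k \<le> l" "l \<le> j k + deg G k" "knot G k l \<le> \<xi> $ k" "\<xi> $ k < knot G k (l + 1)"
        by (rule bspline_nonzero_obtains)
      moreover have "1 \<le> j k" "j k \<le> num G k" using j(1) by (auto simp: index_set_def)
      ultimately show ?thesis by (intro exI[of _ l]) auto
    qed
    then obtain m where "\<And>k. 1 \<le> m k \<and> m k \<le> num G k + deg G k \<and> \<xi> $ k \<in> {knot G k (m k)..<knot G k (m k + 1)}"
      by metis
    then show ?thesis by (auto simp: cell_indices_def knot_cell_def)
  qed
  then show ?thesis by blast
qed

lemma nurbs_param_bounds:
  assumes G: "nurbs_data G" and i: "i \<in> index_set G"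
  shows "0 \<le> nurbs_param G i \<xi>" "nurbs_param G i \<xi> \<le> 1"
proof -
  have nonneg: "0 \<le> weight G j * tensor_bspline G j \<xi>" if "j \<in> index_set G" for j
    using G that tensor_bspline_nonneg[OF G that] by (force simp: nurbs_data_def)
  then have "weight G i * tensor_bspline G i \<xi> \<le> weight_fun G \<xi>"
    unfolding weight_fun_def by (intro member_le_sum i) auto
  with nonneg[OF i] show "0 \<le> nurbs_param G i \<xi>" "nurbs_param G i \<xi> \<le> 1"
    by (auto simp: nurbs_param_def divide_le_eq_1)
qed

section \<open>Measurability of the physical domain and of the NURBS functions\<close>

lemma fsigma_in_imp_fsigma:
  assumes "fsigma_in euclidean S"
  shows "fsigma S"
  using assms unfolding fsigma_in_ascending by (metis closed_closedin fsigma.intros)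

lemma fsigma_in_open: "open S \<Longrightarrow> fsigma_in euclidean (S :: 'a::metric_space set)"
  by (simp add: open_imp_fsigma_in metrizable_space_euclidean)

lemma fsigma_in_closed: "closed S \<Longrightarrow> fsigma_in euclidean S"
  by (simp add: closed_imp_fsigma_in)

text \<open>A relatively open subset of an \<open>F\<^sub>\<sigma>\<close> set in a metric space is \<open>F\<^sub>\<sigma>\<close>, since open sets are.\<close>

lemma fsigma_in_continuous_open_vimage:
  fixes S :: "'a::metric_space set"
  assumes "fsigma_in euclidean S" "continuous_on S f" "open T"
  shows "fsigma_in euclidean {x \<in> S. f x \<in> T}"
proof -
  obtain U where "open U" "U \<inter> S = f -` T \<inter> S"
    using assms(2,3) continuous_on_open_invariant by metis
  then have "{x \<in> S. f x \<in> T} = S \<inter> U" by auto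
  then show ?thesis
    using fsigma_in_Int[OF assms(1) fsigma_in_open[OF \<open>open U\<close>]] by simp
qed

text \<open>In a Heine-Borel space an \<open>F\<^sub>\<sigma>\<close> set is a countable union of compact sets, and continuous
  images of those are compact, hence closed.\<close>

lemma borel_continuous_image_fsigma:
  fixes S :: "'a::{real_normed_vector,heine_borel} set" and f :: "'a \<Rightarrow> 'b::t2_space"
  assumes "fsigma_in euclidean S" "continuous_on S f"
  shows "f ` S \<in> sets borel"
proof -
  obtain F :: "nat \<Rightarrow> 'a set" where F: "range F \<subseteq> Collect compact" "S = \<Union> (range F)"
    using fsigma_in_imp_fsigma[OF assms(1)] fsigma_Union_compact by metis
  have "closed (f ` F n)" for n
  proof (rule compact_imp_closed[OF compact_continuous_image])
    show "continuous_on (F n) f" by (rule continuous_on_subset[OF assms(2)]) (use F(2) in auto)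
    show "compact (F n)" using F(1) by auto
  qed
  then have "(\<Union>n. f ` F n) \<in> sets borel" by auto
  then show ?thesis using F(2) by (simp add: image_UN)
qed

lemma fsigma_knot_cell: "fsigma_in euclidean (knot_cell G m)"
proof -
  define L where "L = {\<xi> :: real ^ 'a. \<forall>k. knot G k (m k) \<le> \<xi> $ k}"
  define U where "U = {\<xi> :: real ^ 'a. \<forall>k. \<xi> $ k < knot G k (m k + 1)}"
  have "closed L"
    unfolding L_def by (intro closed_Collect_all closed_Collect_le continuous_intros)
  moreover have "U = (\<Inter>k. {\<xi>. \<xi> $ k < knot G k (m k + 1)})" by (auto simp: U_def)
  then have "open U"
    by (auto intro!: open_INT open_Collect_less continuous_intros)
  moreover have "knot_cell G m = L \<inter> U" by (auto simp: knot_cell_def L_def U_def)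
  ultimately show ?thesis by (auto intro: fsigma_in_Int fsigma_in_closed fsigma_in_open)
qed

lemma fsigma_param_domain_cell:
  assumes "nurbs_data G" "m \<in> cell_indices G"
  shows "fsigma_in euclidean (param_domain G \<inter> knot_cell G m)"
proof -
  have "fsigma_in euclidean {\<xi> \<in> knot_cell G m. weight_fun G \<xi> \<in> - {0}}"
    by (intro fsigma_in_continuous_open_vimage fsigma_knot_cell continuous_on_weight_fun assms) auto
  then have "fsigma_in euclidean (cbox 0 1 \<inter> {\<xi> \<in> knot_cell G m. weight_fun G \<xi> \<in> - {0}})"
    by (rule fsigma_in_Int[OF fsigma_in_closed[OF closed_cbox]])
  also have "cbox 0 1 \<inter> {\<xi> \<in> knot_cell G m. weight_fun G \<xi> \<in> - {0}} = param_domain G \<inter> knot_cell G m"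
    by (auto simp: param_domain_def)
  finally show ?thesis .
qed

text \<open>A Borel map need not send Borel sets to Borel sets. Here the piecewise structure helps: on each of
  the finitely many knot cells, the set in question is \<open>F\<^sub>\<sigma>\<close> and the geometry map is
  continuous, so the image is \<open>\<sigma>\<close>-compact.\<close>

lemma borel_geo_map_image:
  fixes h :: "real ^ 'd::finite \<Rightarrow> 'b::topological_space"
  assumes G: "nurbs_data G"
    and h: "\<And>m. m \<in> cell_indices G \<Longrightarrow> continuous_on (param_domain G \<inter> knot_cell G m) h"
    and T: "open T"
  shows "geo_map G ` {\<xi> \<in> param_domain G. h \<xi> \<in> T} \<in> sets borel"
proof -
  let ?S = "\<lambda>m. {\<xi> \<in> param_domain G \<inter> knot_cell G m. h \<xi> \<in> T}"
  have "geo_map G ` ?S m \<in> sets borel" if m: "m \<in> cell_indices G" for m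
    by (intro borel_continuous_image_fsigma fsigma_in_continuous_open_vimage fsigma_param_domain_cell
          G m h T continuous_on_subset[OF continuous_on_geo_map[OF G m]]) auto
  then have "(\<Union>m\<in>cell_indices G. geo_map G ` ?S m) \<in> sets borel"
    by (intro sets.finite_UN finite_cell_indices)
  also have "(\<Union>m\<in>cell_indices G. geo_map G ` ?S m) = geo_map G ` {\<xi> \<in> param_domain G. h \<xi> \<in> T}"
    using param_domain_eq_Union_cells[of G] by blast
  finally show ?thesis .
qed

text \<open>The geometry map forms combinations of the control points with coefficients in \<open>[0, 1]\<close>, so its
  image is bounded.\<close>

lemma phys_domain_lmeasurable:
  assumes G: "nurbs_data G"
  shows "phys_domain G \<in> lmeasurable"
proof (rule bounded_set_imp_lmeasurable)
  have "norm (geo_map G \<xi>) \<le> (\<Sum>i\<in>index_set G. norm (ctrl G i))" for \<xi>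
    unfolding geo_map_def
    by (intro sum_norm_le) (use nurbs_param_bounds[OF G] in \<open>auto intro: mult_left_le_one_le\<close>)
  then show "bounded (phys_domain G)"
    unfolding phys_domain_def bounded_iff by blast
  show "phys_domain G \<in> sets lebesgue"
    using borel_geo_map_image[OF G, of "\<lambda>_. 0::real" UNIV] by (simp add: phys_domain_def)
qed

lemma complete_measure_lebesgue_on:
  assumes "D \<in> sets lebesgue"
  shows "complete_measure (lebesgue_on D)"
proof
  fix A B assume "A \<subseteq> B" "B \<in> null_sets (lebesgue_on D)"
  then show "A \<in> sets (lebesgue_on D)"
    using assms null_sets_restrict_space[OF assms] completion.complete2[of A B lborel]
      sets.sets_into_space[of B "lebesgue_on D"]
    by (auto simp: sets_restrict_space_iff null_sets_def)
qed

lemma (in complete_measure) borel_measurable_cong_AE: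
  fixes f g :: "'a \<Rightarrow> real"
  assumes f: "f \<in> borel_measurable M" and ae: "AE x in M. g x = f x"
  shows "g \<in> borel_measurable M"
proof (rule borel_measurableI)
  fix S :: "real set" assume "open S"
  show "g -` S \<inter> space M \<in> sets M"
  proof (rule in_sets_AE)
    show "AE x in M. x \<in> f -` S \<inter> space M \<longleftrightarrow> x \<in> g -` S \<inter> space M"
      using ae by eventually_elim auto
    show "f -` S \<inter> space M \<in> sets M" using f \<open>open S\<close> by (intro measurable_sets) auto
  qed auto
qed

context
  fixes G :: "('d::finite) nurbs"
  assumes G: "nurbs_data G" and inv: "ae_invertible G"
begin

interpretation D: complete_measure "lebesgue_on (phys_domain G)"
  by (rule complete_measure_lebesgue_on) (use phys_domain_lmeasurable[OF G] in auto)

text \<open>At a point with a unique preimage under the geometry map, the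
  value of the function lies in an open set \<open>S\<close> iff the point belongs to the image of the
  set where the parametric function takes values in \<open>S\<close>, and that image is Borel. The points
  without a unique preimage, where the function is unspecified, form a null set, and subsets
  of null sets are measurable.\<close>

lemma borel_measurable_nurbs_phys:
  assumes i: "i \<in> index_set G"
  shows "nurbs_phys G i \<in> borel_measurable (lebesgue_on (phys_domain G))"
proof (rule borel_measurableI)
  fix S :: "real set" assume S: "open S"
  let ?M = "lebesgue_on (phys_domain G)"
  let ?A = "geo_map G ` {\<xi> \<in> param_domain G. nurbs_param G i \<xi> \<in> S}"
  show "nurbs_phys G i -` S \<inter> space ?M \<in> sets ?M"
  proof (rule D.in_sets_AE)
    show "AE x in ?M. x \<in> ?A \<longleftrightarrow> x \<in> nurbs_phys G i -` S \<inter> space ?M"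
      using inv[unfolded ae_invertible_def] AE_space
    proof eventually_elim
      case (elim x)
      then obtain \<xi> where \<xi>: "\<xi> \<in> param_domain G" "geo_map G \<xi> = x"
        and uniq: "\<And>\<eta>. \<eta> \<in> param_domain G \<Longrightarrow> geo_map G \<eta> = x \<Longrightarrow> \<eta> = \<xi>" by blast
      have "the_inv_into (param_domain G) (geo_map G) x = \<xi>"
        unfolding the_inv_into_def using \<xi> uniq by blast
      then have "nurbs_phys G i x = nurbs_param G i \<xi>" by (simp add: nurbs_phys_def)
      moreover have "x \<in> ?A \<longleftrightarrow> nurbs_param G i \<xi> \<in> S" using \<xi> uniq by blast
      ultimately show ?case using elim(2) by simp
    qed
    have "?A \<in> sets lebesgue"
      using borel_geo_map_image[OF G continuous_on_nurbs_param[OF G i] S] by simp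
    moreover have "?A \<subseteq> phys_domain G" by (auto simp: phys_domain_def)
    moreover have "phys_domain G \<in> sets lebesgue"
      using phys_domain_lmeasurable[OF G] by (rule fmeasurableD)
    ultimately show "?A \<in> sets ?M" by (simp add: sets_restrict_space_iff)
  qed auto
qed

lemma nurbs_phys_L2:
  assumes i: "i \<in> index_set G"
  shows "nurbs_phys G i \<in> L2 (lebesgue_on (phys_domain G))"
proof -
  interpret fin: finite_measure "lebesgue_on (phys_domain G)"
    by (rule finite_measure_lebesgue_on[OF phys_domain_lmeasurable[OF G]])
  note [measurable] = borel_measurable_nurbs_phys[OF i]
  have "norm ((nurbs_phys G i x)\<^sup>2) \<le> 1" for x
    using nurbs_param_bounds[OF G i] by (simp add: nurbs_phys_def abs_square_le_1)
  then have "integrable (lebesgue_on (phys_domain G)) (\<lambda>x. (nurbs_phys G i x)\<^sup>2)"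
    by (intro fin.integrable_const_bound[where B = 1]) auto
  then show ?thesis by (simp add: L2_def)
qed

end

section \<open>Square-integrable functions\<close>

lemma L2_measurable: "f \<in> L2 M \<Longrightarrow> f \<in> borel_measurable M"
  by (simp add: L2_def)

lemma integrable_mult_L2:
  assumes "f \<in> L2 M" "g \<in> L2 M"
  shows "integrable M (\<lambda>x. f x * g x)"
proof (rule Bochner_Integration.integrable_bound)
  show "integrable M (\<lambda>x. (f x)\<^sup>2 + (g x)\<^sup>2)" using assms by (simp add: L2_def)
  show "(\<lambda>x. f x * g x) \<in> borel_measurable M"
    using assms by (intro borel_measurable_times L2_measurable)
  have "\<bar>a * b\<bar> \<le> a\<^sup>2 + b\<^sup>2" for a b :: real
  proof -
    have "2 * (\<bar>a\<bar> * \<bar>b\<bar>) \<le> a\<^sup>2 + b\<^sup>2"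
      using sum_squares_bound[of "\<bar>a\<bar>" "\<bar>b\<bar>"] by (simp add: mult.assoc)
    moreover have "0 \<le> \<bar>a\<bar> * \<bar>b\<bar>" by simp
    ultimately show ?thesis unfolding abs_mult by linarith
  qed
  then show "AE x in M. norm (f x * g x) \<le> norm ((f x)\<^sup>2 + (g x)\<^sup>2)" by simp
qed

lemma L2_add:
  assumes "f \<in> L2 M" "g \<in> L2 M"
  shows "(\<lambda>x. f x + g x) \<in> L2 M"
proof -
  have "integrable M (\<lambda>x. (f x)\<^sup>2 + (g x)\<^sup>2 + 2 * (f x * g x))"
    using assms integrable_mult_L2[OF assms] by (intro Bochner_Integration.integrable_add integrable_mult_right) (auto simp: L2_def)
  moreover have "(\<lambda>x. f x + g x) \<in> borel_measurable M"
    using assms by (intro borel_measurable_add L2_measurable)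
  ultimately show ?thesis by (simp add: L2_def power2_sum mult.assoc)
qed

lemma L2_cmult: "f \<in> L2 M \<Longrightarrow> (\<lambda>x. c * f x) \<in> L2 M"
  by (auto simp: L2_def power_mult_distrib intro: borel_measurable_times)

lemma L2_zero: "(\<lambda>x. 0) \<in> L2 M"
  by (simp add: L2_def)

lemma L2_sum:
  assumes "\<And>i. i \<in> I \<Longrightarrow> e i \<in> L2 M"
  shows "(\<lambda>x. \<Sum>i\<in>I. c i * e i x) \<in> L2 M"
  using assms
proof (induction I rule: infinite_finite_induct)
  case (insert i I)
  then have "(\<lambda>x. c i * e i x + (\<Sum>i\<in>I. c i * e i x)) \<in> L2 M"
    by (intro L2_add[OF L2_cmult]) auto
  then show ?case using insert by simp
qed (simp_all add: L2_zero)

lemma L2_cong_AE: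
  assumes "f \<in> L2 M" "AE x in M. g x = f x" "g \<in> borel_measurable M"
  shows "g \<in> L2 M"
proof -
  have "integrable M (\<lambda>x. (g x)\<^sup>2)"
    using assms by (subst integrable_cong_AE[where g = "\<lambda>x. (f x)\<^sup>2"]) (auto simp: L2_def)
  with assms(3) show ?thesis by (simp add: L2_def)
qed

text \<open>The usual discriminant argument: integrate the square of \<open>c * f - b * g\<close>, where
  \<open>c\<close> and \<open>b\<close> are the integrals of \<open>g\<^sup>2\<close> and \<open>f * g\<close>.\<close>

lemma Cauchy_Schwarz_L2:
  assumes f: "f \<in> L2 M" and g: "g \<in> L2 M"
  shows "\<bar>LINT x|M. f x * g x\<bar> \<le> sqrt (LINT x|M. (f x)\<^sup>2) * sqrt (LINT x|M. (g x)\<^sup>2)"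
proof -
  define a b c where "a = (LINT x|M. (f x)\<^sup>2)" and "b = (LINT x|M. f x * g x)"
    and "c = (LINT x|M. (g x)\<^sup>2)"
  have int: "integrable M (\<lambda>x. (f x)\<^sup>2)" "integrable M (\<lambda>x. (g x)\<^sup>2)"
    "integrable M (\<lambda>x. f x * g x)"
    using f g integrable_mult_L2[OF f g] by (auto simp: L2_def)
  have "b\<^sup>2 \<le> a * c"
  proof (cases "c = 0")
    case True
    then have "AE x in M. (g x)\<^sup>2 = 0"
      using integral_nonneg_eq_0_iff_AE[OF int(2)] by (simp add: c_def)
    then have "AE x in M. f x * g x = 0" by eventually_elim simp
    then have "b = 0" unfolding b_def by (rule integral_eq_zero_AE)
    then show ?thesis using True by simp
  next
    case False
    moreover have "0 \<le> c" by (simp add: c_def)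
    ultimately have "0 < c" by simp
    have "0 \<le> (LINT x|M. (c * f x - b * g x)\<^sup>2)" by simp
    also have "\<dots> = (LINT x|M. c\<^sup>2 * (f x)\<^sup>2 - 2 * b * c * (f x * g x) + b\<^sup>2 * (g x)\<^sup>2)"
      by (simp add: power2_eq_square algebra_simps)
    also have "\<dots> = c\<^sup>2 * a - 2 * b * c * b + b\<^sup>2 * c"
      using int by (simp add: a_def b_def c_def)
    also have "\<dots> = c * (a * c - b\<^sup>2)" by (simp add: power2_eq_square algebra_simps)
    finally show ?thesis using \<open>0 < c\<close> by (simp add: zero_le_mult_iff)
  qed
  then have "sqrt (b\<^sup>2) \<le> sqrt (a * c)" by (rule real_sqrt_le_mono)
  then show ?thesis by (simp add: a_def b_def c_def real_sqrt_mult)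
qed

lemma sum_unit_vector_mult:
  fixes a :: "'i \<Rightarrow> real"
  assumes "finite I" "i \<in> I"
  shows "(\<Sum>k\<in>I. (if k = i then 1 else 0) * a k) = a i"
proof -
  have "(\<Sum>k\<in>I. (if k = i then 1 else 0) * a k) = (\<Sum>k\<in>I. if k = i then a k else 0)"
    by (intro sum.cong) auto
  then show ?thesis using assms by simp
qed

text \<open>Bilinearity of the integral of a product, for factors that are expansions only almost everywhere.
  It serves both the mass matrix (with \<open>u = e\<close>) and the operator matrix (with \<open>u j\<close> the image
  of \<open>e j\<close> under the integral operator).\<close>

lemma integral_mult_sums:
  fixes e :: "'i \<Rightarrow> 'a \<Rightarrow> real"
  assumes "finite I" and "\<And>i j. i \<in> I \<Longrightarrow> j \<in> I \<Longrightarrow> integrable M (\<lambda>x. u j x * e i x)"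
    and \<phi>: "AE x in M. \<phi> x = (\<Sum>j\<in>I. f j * u j x)" "\<phi> \<in> borel_measurable M"
    and \<psi>: "AE x in M. \<psi> x = (\<Sum>i\<in>I. c i * e i x)" "\<psi> \<in> borel_measurable M"
  shows "(LINT x|M. \<phi> x * \<psi> x) = (\<Sum>i\<in>I. c i * (\<Sum>j\<in>I. f j * (LINT x|M. u j x * e i x)))"
proof -
  let ?g = "\<lambda>x. \<Sum>i\<in>I. c i * (\<Sum>j\<in>I. f j * (u j x * e i x))"
  have "integrable M ?g" using assms(2) by auto
  moreover have "AE x in M. \<phi> x * \<psi> x = ?g x"
    using \<phi>(1) \<psi>(1)
  proof eventually_elim
    case (elim x)
    have "\<phi> x * \<psi> x = (\<Sum>i\<in>I. c i * e i x) * (\<Sum>j\<in>I. f j * u j x)"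
      using elim by (simp only: mult.commute)
    also have "\<dots> = ?g x"
      by (subst sum_product) (simp add: sum_distrib_left mult_ac)
    finally show ?case .
  qed
  ultimately have "(LINT x|M. \<phi> x * \<psi> x) = (LINT x|M. ?g x)"
    using \<phi>(2) \<psi>(2) by (intro integral_cong_AE) auto
  then show ?thesis using assms(2) by simp
qed

section \<open>Galerkin discretization of an integral operator\<close>

text \<open>Domination by \<open>s x * s y\<close> is stronger than square integrability of the kernel. It is what
  covariances satisfy by Cauchy-Schwarz, and it makes every section \<open>K x\<close> square
  integrable, not only almost every one, so the integral operator is linear at each point.\<close>

locale dominated_kernel = sigma_finite_measure M for M :: "'a measure" +
  fixes K :: "'a \<Rightarrow> 'a \<Rightarrow> real" and s :: "'a \<Rightarrow> real"
  assumes K_measurable [measurable]: "case_prod K \<in> borel_measurable (M \<Otimes>\<^sub>M M)"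
    and s_L2: "s \<in> L2 M"
    and K_le: "\<And>x y. x \<in> space M \<Longrightarrow> y \<in> space M \<Longrightarrow> \<bar>K x y\<bar> \<le> s x * s y"
begin

sublocale pair: pair_sigma_finite M M ..

definition integral_op :: "('a \<Rightarrow> real) \<Rightarrow> 'a \<Rightarrow> real" where
  "integral_op f x = (LINT y|M. K x y * f y)"

lemma integrable_kernel_section:
  assumes "x \<in> space M" "f \<in> L2 M"
  shows "integrable M (\<lambda>y. K x y * f y)"
proof (rule Bochner_Integration.integrable_bound)
  note [measurable] = L2_measurable[OF assms(2)] assms(1)
  show "integrable M (\<lambda>y. s x * (s y * f y))"
    using integrable_mult_L2[OF s_L2 assms(2)] by simp
  show "(\<lambda>y. K x y * f y) \<in> borel_measurable M"
    using measurable_Pair2[OF K_measurable assms(1)] by simp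
  have "\<bar>K x y\<bar> * \<bar>f y\<bar> \<le> \<bar>s x * s y\<bar> * \<bar>f y\<bar>" if "y \<in> space M" for y
    using K_le[OF assms(1) that] by (intro mult_right_mono) auto
  then show "AE y in M. norm (K x y * f y) \<le> norm (s x * (s y * f y))"
    by (intro AE_I2) (simp add: abs_mult mult.assoc)
qed

text \<open>The integrand is dominated by the product of the integrable functions \<open>s * g\<close> and \<open>s * f\<close> of
  one variable each.\<close>

lemma integrable_kernel:
  assumes "f \<in> L2 M" "g \<in> L2 M"
  shows "integrable (M \<Otimes>\<^sub>M M) (\<lambda>(x, y). K x y * f y * g x)"
proof (rule Bochner_Integration.integrable_bound)
  note [measurable] = L2_measurable[OF assms(1)] L2_measurable[OF assms(2)] L2_measurable[OF s_L2]
  have sg: "integrable M (\<lambda>x. s x * g x)" and sf: "integrable M (\<lambda>x. s x * f x)"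
    by (auto intro: integrable_mult_L2 s_L2 assms)
  show "integrable (M \<Otimes>\<^sub>M M) (\<lambda>(x, y). (s x * g x) * (s y * f y))"
  proof (rule pair.Fubini_integrable)
    show "integrable M (\<lambda>x. LINT y|M. norm (case (x, y) of (x, y) \<Rightarrow> s x * g x * (s y * f y)))"
    proof -
      have "integrable M (\<lambda>x. \<bar>s x * g x\<bar> * (LINT y|M. \<bar>s y * f y\<bar>))"
        using sg by (intro integrable_mult_left) auto
      then show ?thesis by (simp add: abs_mult)
    qed
    show "AE x in M. integrable M (\<lambda>y. case (x, y) of (x, y) \<Rightarrow> s x * g x * (s y * f y))"
      using sf by simp
  qed measurable
  show "(\<lambda>(x, y). K x y * f y * g x) \<in> borel_measurable (M \<Otimes>\<^sub>M M)" by measurable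
  have "\<bar>K x y\<bar> * (\<bar>f y\<bar> * \<bar>g x\<bar>) \<le> \<bar>s x * s y\<bar> * (\<bar>f y\<bar> * \<bar>g x\<bar>)" if "x \<in> space M" "y \<in> space M" for x y
    using K_le[OF that] by (intro mult_right_mono) auto
  then show "AE p in M \<Otimes>\<^sub>M M. norm (case p of (x, y) \<Rightarrow> K x y * f y * g x)
      \<le> norm (case p of (x, y) \<Rightarrow> s x * g x * (s y * f y))"
    by (intro AE_I2) (auto simp: space_pair_measure abs_mult mult_ac)
qed

lemma integrable_integral_op_mult:
  assumes "f \<in> L2 M" "g \<in> L2 M"
  shows "integrable M (\<lambda>x. integral_op f x * g x)"
  using pair.integrable_fst[OF integrable_kernel[OF assms]]
  by (simp add: integral_op_def)

lemma integral_op_measurable: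
  assumes "f \<in> L2 M"
  shows "integral_op f \<in> borel_measurable M"
proof -
  note [measurable] = L2_measurable[OF assms]
  show ?thesis unfolding integral_op_def[abs_def] by measurable
qed

text \<open>Fubini's theorem: the entries of the operator matrix are written with the variable of the test function
  inside, whereas the weak form has it outside.\<close>

lemma integral_op_swap:
  assumes "f \<in> L2 M" "g \<in> L2 M"
  shows "(LINT y|M. LINT x|M. K x y * g x * f y) = (LINT x|M. integral_op f x * g x)"
proof -
  have "(LINT y|M. LINT x|M. K x y * f y * g x) = (LINT x|M. LINT y|M. K x y * f y * g x)"
    by (rule pair.Fubini_integral[OF integrable_kernel[OF assms]])
  moreover have "K x y * f y * g x = K x y * g x * f y" for x y by simp
  ultimately have "(LINT y|M. LINT x|M. K x y * g x * f y) = (LINT x|M. LINT y|M. K x y * f y * g x)"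
    by (simp only:)
  then show ?thesis by (simp only: integral_op_def integral_mult_left_zero)
qed

lemma integral_op_sum:
  assumes "finite I" "\<And>j. j \<in> I \<Longrightarrow> e j \<in> L2 M" "\<phi> \<in> L2 M"
    and "AE x in M. \<phi> x = (\<Sum>j\<in>I. f j * e j x)" and x: "x \<in> space M"
  shows "integral_op \<phi> x = (\<Sum>j\<in>I. f j * integral_op (e j) x)"
proof -
  have int: "integrable M (\<lambda>y. K x y * e j y)" if "j \<in> I" for j
    by (rule integrable_kernel_section[OF x assms(2)[OF that]])
  have "integral_op \<phi> x = (LINT y|M. (\<Sum>j\<in>I. f j * (K x y * e j y)))"
    unfolding integral_op_def
  proof (rule integral_cong_AE)
    show "AE y in M. K x y * \<phi> y = (\<Sum>j\<in>I. f j * (K x y * e j y))"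
      using assms(4) by eventually_elim (simp add: sum_distrib_left mult_ac)
  qed (use integrable_kernel_section[OF x assms(3)] int in auto)
  also have "\<dots> = (\<Sum>j\<in>I. f j * integral_op (e j) x)"
    using int by (simp add: integral_op_def)
  finally show ?thesis .
qed

text \<open>Expand trial and test function in the generators. By bilinearity both sides of the weak equation are
  \<open>\<Sum>i\<in>I. c i * r i\<close>, where \<open>c\<close> holds the coefficients of the test function and \<open>r i\<close> is the
  corresponding side of row \<open>i\<close> of the matrix equation. Testing with \<open>e i\<close> isolates row \<open>i\<close>;
  conversely the rows add up to every test function. Any coefficient
  vector of \<open>\<phi>\<close> is nonzero because \<open>\<phi>\<close> is, also when the generators are linearly dependent.\<close>

theorem galerkin_iff_matrix_eigenproblem:
  fixes e :: "'i \<Rightarrow> 'a \<Rightarrow> real"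
  assumes I: "finite I" and e: "\<And>i. i \<in> I \<Longrightarrow> e i \<in> L2 M"
    and V: "V \<subseteq> L2 M" "\<And>\<phi>. \<phi> \<in> V \<Longrightarrow> \<exists>c. AE x in M. \<phi> x = (\<Sum>i\<in>I. c i * e i x)"
    and eV: "\<And>i. i \<in> I \<Longrightarrow> e i \<in> V"
    and \<phi>: "\<phi> \<in> V" "\<not> (AE x in M. \<phi> x = 0)"
  shows "(\<forall>\<psi>\<in>V. (LINT x|M. integral_op \<phi> x * \<psi> x) = l * (LINT x|M. \<phi> x * \<psi> x)) \<longleftrightarrow>
    (\<exists>f. (\<exists>j\<in>I. f j \<noteq> 0) \<and> (AE x in M. \<phi> x = (\<Sum>j\<in>I. f j * e j x)) \<and>
      (\<forall>i\<in>I. (\<Sum>j\<in>I. (LINT x|M. integral_op (e j) x * e i x) * f j) =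
             l * (\<Sum>j\<in>I. (LINT x|M. e i x * e j x) * f j)))"
    (is "?weak \<longleftrightarrow> (\<exists>f. ?nz f \<and> ?rep f \<and> ?matrix f)")
proof -
  have op_form: "(LINT x|M. integral_op \<phi> x * \<psi> x) =
        (\<Sum>i\<in>I. c i * (\<Sum>j\<in>I. (LINT x|M. integral_op (e j) x * e i x) * f j))"
    and mass_form: "(LINT x|M. \<phi> x * \<psi> x) =
        (\<Sum>i\<in>I. c i * (\<Sum>j\<in>I. (LINT x|M. e i x * e j x) * f j))"
    if f: "?rep f" and \<psi>: "\<psi> \<in> L2 M" "AE x in M. \<psi> x = (\<Sum>i\<in>I. c i * e i x)" for f c \<psi>
  proof -
    have \<phi>2: "\<phi> \<in> L2 M" using \<phi>(1) V(1) by auto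
    have "AE x in M. integral_op \<phi> x = (\<Sum>j\<in>I. f j * integral_op (e j) x)"
      using integral_op_sum[OF I e \<phi>2 f] by (intro AE_I2)
    then show "(LINT x|M. integral_op \<phi> x * \<psi> x) =
        (\<Sum>i\<in>I. c i * (\<Sum>j\<in>I. (LINT x|M. integral_op (e j) x * e i x) * f j))"
      using integral_mult_sums[OF I integrable_integral_op_mult[OF e e] _
          integral_op_measurable[OF \<phi>2] \<psi>(2) L2_measurable[OF \<psi>(1)]]
      by (simp add: mult.commute)
    show "(LINT x|M. \<phi> x * \<psi> x) = (\<Sum>i\<in>I. c i * (\<Sum>j\<in>I. (LINT x|M. e i x * e j x) * f j))"
      using integral_mult_sums[OF I integrable_mult_L2[OF e e] f L2_measurable[OF \<phi>2] \<psi>(2) L2_measurable[OF \<psi>(1)]]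
      by (simp add: mult.commute)
  qed
  show ?thesis
  proof
    assume weak: ?weak
    obtain f where f: "?rep f" using V(2)[OF \<phi>(1)] by blast
    have "?nz f"
    proof (rule ccontr)
      assume "\<not> ?nz f"
      then show False using f \<phi>(2) by simp
    qed
    moreover have "?matrix f"
    proof
      fix i assume i: "i \<in> I"
      note single = sum_unit_vector_mult[OF I i]
      have "AE x in M. e i x = (\<Sum>k\<in>I. (if k = i then 1 else 0) * e k x)"
        by (simp only: single) simp
      from op_form[OF f e[OF i] this] mass_form[OF f e[OF i] this] weak eV[OF i]
      show "(\<Sum>j\<in>I. (LINT x|M. integral_op (e j) x * e i x) * f j) =
             l * (\<Sum>j\<in>I. (LINT x|M. e i x * e j x) * f j)"
        unfolding single by simp
    qed
    ultimately show "\<exists>f. ?nz f \<and> ?rep f \<and> ?matrix f" using f by blast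
  next
    assume "\<exists>f. ?nz f \<and> ?rep f \<and> ?matrix f"
    then obtain f where f: "?rep f" and matrix: "?matrix f" by blast
    show ?weak
    proof
      fix \<psi> assume "\<psi> \<in> V"
      then obtain c where \<psi>: "\<psi> \<in> L2 M" "AE x in M. \<psi> x = (\<Sum>i\<in>I. c i * e i x)"
        using V by blast
      show "(LINT x|M. integral_op \<phi> x * \<psi> x) = l * (LINT x|M. \<phi> x * \<psi> x)"
      proof -
        have "(\<Sum>i\<in>I. c i * (\<Sum>j\<in>I. (LINT x|M. integral_op (e j) x * e i x) * f j)) =
          (\<Sum>i\<in>I. c i * (l * (\<Sum>j\<in>I. (LINT x|M. e i x * e j x) * f j)))"
          using matrix by (intro sum.cong arg_cong2[where f = "(*)"]) auto
        also have "\<dots> = l * (\<Sum>i\<in>I. c i * (\<Sum>j\<in>I. (LINT x|M. e i x * e j x) * f j))"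
          by (subst sum_distrib_left) (simp only: mult.left_commute)
        finally show ?thesis unfolding op_form[OF f \<psi>] mass_form[OF f \<psi>] .
      qed
    qed
  qed
qed

end

section \<open>Covariance kernels\<close>

text \<open>The dominating function is the standard deviation of the field. Cauchy-Schwarz on the probability space
  gives the bound, and the standard deviation is square integrable because the variance is at
  most the second moment, which is integrable over the domain by Fubini.\<close>

lemma covariance_dominated_kernel:
  assumes M: "sigma_finite_measure M" and P: "prob_space P" and \<alpha>: "L2_random_field M P \<alpha>"
  shows "dominated_kernel M (covariance P \<alpha>) (\<lambda>x. sqrt (covariance P \<alpha> x x))"
proof -
  interpret M: sigma_finite_measure M by fact
  interpret P: prob_space P by fact
  interpret MP: pair_sigma_finite M P ..
  have \<alpha>_meas [measurable]: "case_prod \<alpha> \<in> borel_measurable (M \<Otimes>\<^sub>M P)"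
    and \<alpha>_sq: "integrable (M \<Otimes>\<^sub>M P) (\<lambda>(x, \<omega>). (\<alpha> x \<omega>)\<^sup>2)"
    and \<alpha>_L2: "\<And>x. x \<in> space M \<Longrightarrow> \<alpha> x \<in> L2 P"
    using \<alpha> by (auto simp: L2_random_field_def L2_def case_prod_unfold)
  have mean_meas [measurable]: "mean_fun P \<alpha> \<in> borel_measurable M"
    unfolding mean_fun_def[abs_def] by measurable
  have meas: "(\<lambda>(x, y). covariance P \<alpha> x y) \<in> borel_measurable (M \<Otimes>\<^sub>M M)"
    unfolding covariance_def[abs_def] by measurable
  have diag_meas [measurable]: "(\<lambda>x. covariance P \<alpha> x x) \<in> borel_measurable M"
    using measurable_compose[OF measurable_Pair[OF measurable_ident measurable_ident] meas] by simp
  have centred: "(\<lambda>\<omega>. \<alpha> x \<omega> - mean_fun P \<alpha> x) \<in> L2 P" if "x \<in> space M" for x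
    using L2_add[OF \<alpha>_L2[OF that], of "\<lambda>_. - mean_fun P \<alpha> x"] by (simp add: L2_def)
  have diag: "covariance P \<alpha> x x = (LINT \<omega>|P. (\<alpha> x \<omega> - mean_fun P \<alpha> x)\<^sup>2)" for x
    by (simp add: covariance_def power2_eq_square)
  have diag_nonneg: "0 \<le> covariance P \<alpha> x x" for x
    by (simp add: diag)
  have diag_le: "covariance P \<alpha> x x \<le> (LINT \<omega>|P. (\<alpha> x \<omega>)\<^sup>2)" if x: "x \<in> space M" for x
  proof -
    have sq: "\<alpha> x \<in> borel_measurable P" "integrable P (\<lambda>\<omega>. (\<alpha> x \<omega>)\<^sup>2)"
      using \<alpha>_L2[OF x] by (simp_all add: L2_def)
    then have "integrable P (\<alpha> x)" by (rule P.square_integrable_imp_integrable)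
    note int = sq(2) this
    show ?thesis
      unfolding diag mean_fun_def using P.variance_eq[OF int(2,1)] by simp
  qed
  show ?thesis
  proof
    show "case_prod (covariance P \<alpha>) \<in> borel_measurable (M \<Otimes>\<^sub>M M)" using meas by simp
    have "integrable M (\<lambda>x. covariance P \<alpha> x x)"
    proof (rule Bochner_Integration.integrable_bound[OF MP.integrable_fst[OF \<alpha>_sq]])
      show "AE x in M. norm (covariance P \<alpha> x x) \<le> norm (LINT \<omega>|P. (\<alpha> x \<omega>)\<^sup>2)"
        using diag_le diag_nonneg by (intro AE_I2) simp
    qed measurable
    then show "(\<lambda>x. sqrt (covariance P \<alpha> x x)) \<in> L2 M"
      using diag_nonneg by (simp add: L2_def)
    show "\<bar>covariance P \<alpha> x y\<bar> \<le> sqrt (covariance P \<alpha> x x) * sqrt (covariance P \<alpha> y y)"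
      if "x \<in> space M" "y \<in> space M" for x y
      using Cauchy_Schwarz_L2[OF centred[OF that(1)] centred[OF that(2)]]
      unfolding covariance_def power2_eq_square .
  qed
qed

section \<open>The NURBS Galerkin space\<close>

text \<open>The span is generated by the set of values of \<open>e\<close>, whereas the sum runs over indices, and \<open>e\<close> may
  take a value repeatedly. Since the index sums form a subspace that contains each generator,
  repetitions do no harm.\<close>

lemma span_image_imp_sum:
  fixes e :: "'i \<Rightarrow> 'a \<Rightarrow> real"
  assumes I: "finite I" and g: "g \<in> module.span (\<lambda>(c::real) f x. c * f x) (e ` I)"
  shows "\<exists>c. \<forall>x. g x = (\<Sum>i\<in>I. c i * e i x)"
proof -
  interpret fn: module "\<lambda>(c::real) (f :: 'a \<Rightarrow> real) x. c * f x"
    by unfold_locales (auto simp: fun_eq_iff algebra_simps)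
  let ?S = "{g. \<exists>c. \<forall>x. g x = (\<Sum>i\<in>I. c i * e i x)}"
  have "fn.span (e ` I) \<subseteq> ?S"
  proof (rule fn.span_minimal)
    show "e ` I \<subseteq> ?S"
    proof clarsimp
      fix i assume i: "i \<in> I"
      have "\<forall>x. e i x = (\<Sum>k\<in>I. (if k = i then 1 else 0) * e k x)"
        by (simp only: sum_unit_vector_mult[OF I i]) simp
      then show "\<exists>c. \<forall>x. e i x = (\<Sum>k\<in>I. c k * e k x)"
        by (rule exI[where x = "\<lambda>k. if k = i then 1 else 0"])
    qed
    show "fn.subspace ?S"
    proof (rule fn.subspaceI)
      show "0 \<in> ?S" by (auto intro!: exI[of _ "\<lambda>_. 0"])
    next
      fix f g assume "f \<in> ?S" "g \<in> ?S"
      then obtain a b where "\<forall>x. f x = (\<Sum>i\<in>I. a i * e i x)" "\<forall>x. g x = (\<Sum>i\<in>I. b i * e i x)"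
        by blast
      then have "\<forall>x. (f + g) x = (\<Sum>i\<in>I. (a i + b i) * e i x)"
        by (simp add: sum.distrib distrib_right)
      then show "f + g \<in> ?S" by (intro CollectI exI[of _ "\<lambda>i. a i + b i"])
    next
      fix r f assume "f \<in> ?S"
      then obtain a where "\<forall>x. f x = (\<Sum>i\<in>I. a i * e i x)" by blast
      then have "\<forall>x. r * f x = (\<Sum>i\<in>I. (r * a i) * e i x)"
        by (simp add: sum_distrib_left mult.assoc)
      then show "(\<lambda>x. r * f x) \<in> ?S" by (intro CollectI exI[of _ "\<lambda>i. r * a i"])
    qed
  qed
  then show ?thesis using g by auto
qed

lemma galerkin_space_imp_sum:
  assumes "\<phi> \<in> galerkin_space G"
  shows "\<exists>c. AE x in lebesgue_on (phys_domain G).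
    \<phi> x = (\<Sum>i\<in>index_set G. c i * nurbs_phys G i x)"
proof -
  obtain g where g: "g \<in> module.span (\<lambda>(c::real) f x. c * f x) (nurbs_phys G ` index_set G)"
    and ae: "AE x in lebesgue_on (phys_domain G). \<phi> x = g x"
    using assms unfolding galerkin_space_def by blast
  obtain c where "\<forall>x. g x = (\<Sum>i\<in>index_set G. c i * nurbs_phys G i x)"
    using span_image_imp_sum[OF finite_index_set g] by blast
  with ae show ?thesis by (intro exI[of _ c]) simp
qed

lemma nurbs_phys_in_galerkin_space:
  assumes "i \<in> index_set G"
  shows "nurbs_phys G i \<in> galerkin_space G"
proof -
  interpret fn: module "\<lambda>(c::real) (f :: real ^ 'a \<Rightarrow> real) x. c * f x"
    by unfold_locales (auto simp: fun_eq_iff algebra_simps)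
  have "nurbs_phys G i \<in> fn.span (nurbs_phys G ` index_set G)"
    using assms by (intro fn.span_base) auto
  then show ?thesis unfolding galerkin_space_def by (intro CollectI bexI AE_I2) auto
qed

text \<open>Membership in the space is only equality almost everywhere with an element of the span; it is
  completeness of Lebesgue measure that carries measurability over.\<close>

lemma galerkin_space_subset_L2:
  assumes G: "nurbs_data G" and inv: "ae_invertible G"
  shows "galerkin_space G \<subseteq> L2 (lebesgue_on (phys_domain G))"
proof
  interpret D: complete_measure "lebesgue_on (phys_domain G)"
    by (rule complete_measure_lebesgue_on) (use phys_domain_lmeasurable[OF G] in auto)
  fix \<phi> assume "\<phi> \<in> galerkin_space G"
  then obtain c where ae: "AE x in lebesgue_on (phys_domain G).
      \<phi> x = (\<Sum>i\<in>index_set G. c i * nurbs_phys G i x)"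
    using galerkin_space_imp_sum by blast
  have sum: "(\<lambda>x. \<Sum>i\<in>index_set G. c i * nurbs_phys G i x) \<in> L2 (lebesgue_on (phys_domain G))"
    by (intro L2_sum nurbs_phys_L2 G inv)
  show "\<phi> \<in> L2 (lebesgue_on (phys_domain G))"
    by (rule L2_cong_AE[OF sum ae D.borel_measurable_cong_AE[OF L2_measurable[OF sum] ae]])
qed

theorem theorem8:
  fixes G :: "('d::finite) nurbs"
    and P :: "'w measure"
    and \<alpha> :: "real ^ 'd \<Rightarrow> 'w \<Rightarrow> real"
    and \<Gamma> :: "real ^ 'd \<Rightarrow> real ^ 'd \<Rightarrow> real"
    and D :: "(real ^ 'd) set"
  assumes "CARD('d) \<in> {1, 2, 3}"
    and "nurbs_data G"
    and "ae_invertible G"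
    and "elementwise_smooth_inverse G"
    and "D = phys_domain G"
    and "prob_space P" and "complete_measure P"
    and "L2_random_field (lebesgue_on D) P \<alpha>"
    and "\<Gamma> = covariance P \<alpha>"
  shows "galerkin_space G \<subseteq> L2 (lebesgue_on D) \<and>
    (\<forall>l \<phi>. 0 \<le> l \<and> \<phi> \<in> galerkin_space G \<and> \<not> (AE x in lebesgue_on D. \<phi> x = 0) \<longrightarrow>
       (solves_variational D \<Gamma> (galerkin_space G) l \<phi> \<longleftrightarrow>
        (\<exists>f :: ('d \<Rightarrow> nat) \<Rightarrow> real.
           (\<exists>j\<in>index_set G. f j \<noteq> 0) \<and>
           (AE x in lebesgue_on D. \<phi> x = (\<Sum>j\<in>index_set G. f j * nurbs_phys G j x)) \<and>
           (\<forall>i\<in>index_set G. (\<Sum>j\<in>index_set G. galerkin_A G \<Gamma> i j * f j) =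
                            l * (\<Sum>j\<in>index_set G. galerkin_B G i j * f j)))))"
proof -
  let ?M = "lebesgue_on D"
  let ?V = "galerkin_space G"
  have "finite_measure ?M"
    unfolding assms(5) by (rule finite_measure_lebesgue_on[OF phys_domain_lmeasurable[OF assms(2)]])
  then have sf: "sigma_finite_measure ?M"
    by (simp add: finite_measure_def)
  interpret DK: dominated_kernel ?M \<Gamma> "\<lambda>x. sqrt (covariance P \<alpha> x x)"
    unfolding assms(9) by (rule covariance_dominated_kernel[OF sf assms(6,8)])
  have V: "?V \<subseteq> L2 ?M"
    unfolding assms(5) by (rule galerkin_space_subset_L2[OF assms(2,3)])
  have R: "nurbs_phys G i \<in> L2 ?M" if "i \<in> index_set G" for i
    unfolding assms(5) by (rule nurbs_phys_L2[OF assms(2,3) that])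
  have coeffs: "\<exists>c. AE x in ?M. \<phi> x = (\<Sum>i\<in>index_set G. c i * nurbs_phys G i x)"
    if "\<phi> \<in> ?V" for \<phi>
    unfolding assms(5) by (rule galerkin_space_imp_sum[OF that])
  have weak: "solves_variational D \<Gamma> ?V l \<phi> \<longleftrightarrow>
      (\<forall>\<psi>\<in>?V. (LINT x|?M. DK.integral_op \<phi> x * \<psi> x) = l * (LINT x|?M. \<phi> x * \<psi> x))" for l \<phi>
    by (simp only: solves_variational_def DK.integral_op_def)
  have A: "galerkin_A G \<Gamma> i j =
      (LINT x|?M. DK.integral_op (nurbs_phys G j) x * nurbs_phys G i x)"
    if "i \<in> index_set G" "j \<in> index_set G" for i j
    unfolding galerkin_A_def assms(5)[symmetric] by (rule DK.integral_op_swap[OF R R]) (use that in auto)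
  have B: "galerkin_B G i j = (LINT x|?M. nurbs_phys G i x * nurbs_phys G j x)" for i j
    unfolding galerkin_B_def assms(5)[symmetric] ..
  show ?thesis
  proof (intro conjI allI impI V, elim conjE)
    fix l \<phi> assume \<phi>: "\<phi> \<in> ?V" "\<not> (AE x in ?M. \<phi> x = 0)"
    show "solves_variational D \<Gamma> ?V l \<phi> \<longleftrightarrow>
        (\<exists>f :: ('d \<Rightarrow> nat) \<Rightarrow> real.
           (\<exists>j\<in>index_set G. f j \<noteq> 0) \<and>
           (AE x in ?M. \<phi> x = (\<Sum>j\<in>index_set G. f j * nurbs_phys G j x)) \<and>
           (\<forall>i\<in>index_set G. (\<Sum>j\<in>index_set G. galerkin_A G \<Gamma> i j * f j) =
                            l * (\<Sum>j\<in>index_set G. galerkin_B G i j * f j)))"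
      using DK.galerkin_iff_matrix_eigenproblem[where e = "nurbs_phys G" and l = l,
          OF finite_index_set R V coeffs nurbs_phys_in_galerkin_space \<phi>]
      unfolding weak by (simp add: A B)
  qed
qed

end
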